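(* There exist functions $n_0(k,t)$ and $n_1(c,t)$ such that the following holds for all positive integers $n,k,t,c$ with $k\ge t\ge 1$ and $n=ck$. If ($n\ge n_0(k,t)$) or ($c\ge t+2$ and $n\ge n_1(c,t)$), and $\mathcal{P}\subseteq\mathcal{U}^n_k$ is a $t$-intersecting uniform partition system, then (1) $|\mathcal{P}|\le U(n-tc,k-t)$; (2) this bound is tight (i.e. holds with equality) if and only if $\mathcal{P}$ is a trivially $t$-intersecting uniform partition system.
   Context: For $n=ck$, $\mathcal{U}^n_k$ is the set of all uniform $k$-partitions of $\{1,\dots,n\}$, i.e. partitions into $k$ classes each of size $c=n/k$, and $U(n,k)=|\mathcal{U}^n_k|=\frac1{k!}\binom nc\binom{n-c}c\cdots\binom cc$ (with $U(0,0)=1$). A set $\mathcal{P}\subseteq\mathcal{U}^n_k$ is $t$-intersecting if $|P\cap Q|\ge t$ for all $P,Q\in\mathcal{P}$, where $P\cap Q$ is the set of classes common to $P$ and $Q$. A set $\mathcal{P}\subseteq\mathcal{U}^n_k$ is a trivially $t$-intersecting uniform partition system if, up to a permutation of $\{1,\dots,n\}$, it equals $$\{P\in\mathcal{U}^n_k:\ \{[1,c],[c+1,2c],\dots,[(t-1)c+1,tc]\}\subseteq P\},$$ where $[a,b]=\{a,a+1,\dots,b\}$; that is, it consists of all uniform $k$-partitions containing $t$ fixed pairwise disjoint $c$-sets as classes. *)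

theory Defs
  imports Main "HOL-Library.Disjoint_Sets" "HOL-Combinatorics.Permutations"
begin

text \<open>
  If \<open>k\<close> does not divide \<open>n\<close>, this set is empty, since \<open>k\<close> disjoint classes of size
  \<open>n div k\<close> do not cover \<open>{1..n}\<close>.
\<close>

definition uniform_partitions :: "nat \<Rightarrow> nat \<Rightarrow> nat set set set" where
  "uniform_partitions n k =
     {P. partition_on {1..n} P \<and> card P = k \<and> (\<forall>A\<in>P. card A = n div k)}"

definition num_uniform_partitions :: "nat \<Rightarrow> nat \<Rightarrow> nat" where
  "num_uniform_partitions n k = card (uniform_partitions n k)"

definition t_intersecting :: "nat \<Rightarrow> nat set set set \<Rightarrow> bool" where
  "t_intersecting t \<P> \<longleftrightarrow> (\<forall>P\<in>\<P>. \<forall>Q\<in>\<P>. t \<le> card (P \<inter> Q))"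

text \<open>
  The fixed classes are the intervals \<open>[i c + 1, (i + 1) c]\<close> for \<open>i < t\<close>, where \<open>c = n div k\<close>.
\<close>

definition canonical_system :: "nat \<Rightarrow> nat \<Rightarrow> nat \<Rightarrow> nat set set set" where
  "canonical_system n k t =
     {P \<in> uniform_partitions n k.
        (\<lambda>i. {i * (n div k) + 1..(i + 1) * (n div k)}) ` {..<t} \<subseteq> P}"

text \<open>
  A permutation of the ground set acts on a class by taking its image, hence on a partition
  classwise and on a partition system elementwise.
\<close>

definition trivially_t_intersecting :: "nat \<Rightarrow> nat \<Rightarrow> nat \<Rightarrow> nat set set set \<Rightarrow> bool" where
  "trivially_t_intersecting n k t \<P> \<longleftrightarrow>
     (\<exists>\<sigma>. \<sigma> permutes {1..n} \<and> \<P> = (\<lambda>P. (\<lambda>A. \<sigma> ` A) ` P) ` canonical_system n k t)"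

text \<open>The convention \<open>U(0,0) = 1\<close> holds automatically.\<close>

lemma num_uniform_partitions_0_0: "num_uniform_partitions 0 0 = 1"
proof -
  have "uniform_partitions 0 0 = {{}}"
    by (auto simp: uniform_partitions_def partition_on_empty)
  then show ?thesis
    by (simp add: num_uniform_partitions_def)
qed

end

theory Submission
  imports Defs Complex_Main
begin

text \<open>
  Write \<open>U(j)\<close> for the number of partitions of a set of \<open>c j\<close> points into classes of size \<open>c\<close>.
  Exactly \<open>U(k - |T|)\<close> partitions of \<open>c k\<close> points contain a given family \<open>T\<close> of disjoint
  \<open>c\<close>-sets, since the remaining classes may be chosen freely
  (\<open>card_c_partitions_containing\<close>). So if all members of a \<open>t\<close>-intersecting system \<open>\<P>\<close> contain
  the same \<open>t\<close> classes, then \<open>|\<P>| \<le> U(k - t)\<close>, with equality exactly when \<open>\<P>\<close> consists of all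
  the partitions containing these classes. As any \<open>t\<close> disjoint \<open>c\<close>-sets can be moved to the
  first \<open>t\<close> intervals by a permutation of the ground set, these are precisely the trivially
  \<open>t\<close>-intersecting systems (\<open>trivially_t_intersecting_iff\<close>).

  It remains to see that every other \<open>t\<close>-intersecting system is strictly smaller. Fix
  \<open>P \<in> \<P>\<close>. Each member of \<open>\<P>\<close> contains one of the \<open>k choose t\<close> sets \<open>T\<close> of \<open>t\<close> classes of \<open>P\<close>.
  Since \<open>T\<close> is not common to all of \<open>\<P>\<close>, some \<open>Q \<in> \<P>\<close> omits a class of \<open>T\<close>, and then a member
  of \<open>\<P>\<close> that contains \<open>T\<close> can share \<open>t\<close> classes with \<open>Q\<close> only by containing one of the at
  most \<open>k\<close> classes in \<open>Q - T\<close> as well. Hence \<open>|\<P>| \<le> (k choose t) k U(k - t - 1)\<close>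
  (\<open>card_nontrivial_t_intersecting_le\<close>). On the other hand,
  \<open>U(k - t) = (c (k - t) - 1 choose (c - 1)) U(k - t - 1)\<close>, as one chooses the class of the first
  point and then partitions the rest (\<open>num_uniform_partitions_Suc\<close>).

  Thus for \<open>k \<ge> t + 2\<close> one needs \<open>(k choose t) k < (c (k - t) - 1 choose (c - 1))\<close>. For fixed
  \<open>k\<close> and \<open>t\<close> the right side is at least \<open>c\<close>, hence large with \<open>c\<close>. For fixed \<open>c\<close> and \<open>t\<close> it is
  larger than \<open>k ^ (c - 1)\<close> as soon as \<open>k \<ge> t c + 2\<close>, while the left side is at most
  \<open>k ^ (t + 1)\<close>; this is where \<open>c \<ge> t + 2\<close> enters. Finally, for \<open>k \<le> t + 1\<close> two partitions with
  \<open>t\<close> common classes coincide, because at most one class is left over.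
\<close>

section \<open>Partitions into classes of size c\<close>

definition c_partitions :: "nat \<Rightarrow> 'a set \<Rightarrow> 'a set set set" where
  "c_partitions c S = {P. partition_on S P \<and> (\<forall>A\<in>P. card A = c)}"

text \<open>
  Every set of classes of a \<open>c\<close>-partition of \<open>S\<close> has this shape. Conversely, if \<open>c \<ge> 1\<close> divides
  the size of a finite \<open>S\<close>, every such family extends to a \<open>c\<close>-partition of \<open>S\<close>.
\<close>

definition class_family :: "nat \<Rightarrow> 'a set \<Rightarrow> 'a set set \<Rightarrow> bool" where
  "class_family c S T \<longleftrightarrow> T \<subseteq> Pow S \<and> disjoint T \<and> (\<forall>A\<in>T. card A = c)"

definition c_partitions_containing :: "nat \<Rightarrow> 'a set \<Rightarrow> 'a set set \<Rightarrow> 'a set set set" where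
  "c_partitions_containing c S T = {P \<in> c_partitions c S. T \<subseteq> P}"

lemma c_partitions_subset: "c_partitions c S \<subseteq> Pow (Pow S)"
  by (auto simp: c_partitions_def partition_on_def)

lemma finite_c_partitions [simp]: "finite S \<Longrightarrow> finite (c_partitions c S)"
  using c_partitions_subset by (rule finite_subset) simp

lemma finite_c_partitions_containing [simp]:
  "finite S \<Longrightarrow> finite (c_partitions_containing c S T)"
  by (simp add: c_partitions_containing_def)

lemma card_class_family:
  assumes "finite S" "class_family c S T"
  shows "finite T" "card (\<Union>T) = c * card T"
proof -
  have "T \<subseteq> Pow S" "disjoint T" and c: "\<forall>A\<in>T. card A = c"
    using assms by (auto simp: class_family_def)
  then show "finite T"
    using assms(1) by (meson finite_Pow_iff finite_subset)
  have "card (\<Union>T) = sum card T"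
    using \<open>T \<subseteq> Pow S\<close> \<open>disjoint T\<close> assms(1)
    by (intro card_Union_disjoint) (auto intro: finite_subset)
  then show "card (\<Union>T) = c * card T"
    using c by simp
qed

lemma class_family_if_subset:
  assumes "P \<in> c_partitions c S" "T \<subseteq> P"
  shows "class_family c S T"
  using assms
  by (auto simp: c_partitions_def class_family_def partition_on_def pairwise_subset)

lemma card_c_partition:
  assumes "finite S" "c \<ge> 1" "card S = c * k" "P \<in> c_partitions c S"
  shows "finite P" "card P = k"
proof -
  have *: "class_family c S P"
    using assms(4) by (rule class_family_if_subset) simp
  have "\<Union>P = S"
    using assms(4) by (auto simp: c_partitions_def partition_on_def)
  then show "finite P" "card P = k"
    using card_class_family[OF assms(1) *] assms(2,3) by auto
qed

text \<open>
  For \<open>k \<ge> 1\<close> the number of classes is forced by their size. For \<open>k = 0\<close> the class size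
  \<open>0 div 0 = 0\<close> prescribed on the left differs from \<open>c\<close>, but the empty partition is the only
  candidate on both sides.
\<close>

lemma uniform_partitions_eq_c_partitions:
  assumes "c \<ge> 1"
  shows "uniform_partitions (c * k) k = c_partitions c {1..c * k}"
proof (cases "k = 0")
  case True
  then show ?thesis
    by (auto simp: uniform_partitions_def c_partitions_def partition_on_empty)
next
  case False
  then show ?thesis
    using card_c_partition(2)[of "{1..c * k}" c k] assms
    by (auto simp: uniform_partitions_def c_partitions_def)
qed

lemma image_c_partition:
  assumes "bij_betw f S S'" "P \<in> c_partitions c S"
  shows "(\<lambda>A. f ` A) ` P \<in> c_partitions c S'"
proof -
  have P: "partition_on S P" "\<forall>A\<in>P. card A = c"
    using assms(2) by (auto simp: c_partitions_def)
  have f: "inj_on f S" "f ` S = S'"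
    using assms(1) by (auto simp: bij_betw_def)
  have "(\<lambda>A. f ` A) ` P - {{}} = (\<lambda>A. f ` A) ` P"
    using partition_onD3[OF P(1)] by auto
  then have "partition_on S' ((\<lambda>A. f ` A) ` P)"
    using partition_on_inj_image[OF P(1) f(1)] f(2) by simp
  moreover have "card (f ` A) = c" if "A \<in> P" for A
  proof -
    have "A \<subseteq> S"
      using that P(1) by (auto simp: partition_on_def)
    then show ?thesis
      using that P(2) f(1) by (metis card_image inj_on_subset)
  qed
  ultimately show ?thesis
    by (auto simp: c_partitions_def)
qed

text \<open>
  With \<open>T = {}\<close> this shows that the number of \<open>c\<close>-partitions depends only on the size of the
  ground set; with \<open>S = S'\<close> it describes the action of a permutation on the trivially
  intersecting systems.
\<close>

lemma image_c_partitions_containing: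
  assumes f: "bij_betw f S S'" and T: "T \<subseteq> Pow S"
  shows "(\<lambda>P. (\<lambda>A. f ` A) ` P) ` c_partitions_containing c S T
           = c_partitions_containing c S' ((\<lambda>A. f ` A) ` T)"
proof (intro equalityI subsetI)
  fix Q assume "Q \<in> (\<lambda>P. (\<lambda>A. f ` A) ` P) ` c_partitions_containing c S T"
  then show "Q \<in> c_partitions_containing c S' ((\<lambda>A. f ` A) ` T)"
    using image_c_partition[OF f] by (auto simp: c_partitions_containing_def)
next
  fix Q assume Q: "Q \<in> c_partitions_containing c S' ((\<lambda>A. f ` A) ` T)"
  define g where "g = inv_into S f"
  have g: "bij_betw g S' S"
    using f by (simp add: g_def bij_betw_inv_into)
  have fg: "f ` g ` A = A" if "A \<subseteq> S'" for A
    using that f by (auto simp: g_def bij_betw_def image_inv_into_cancel)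
  have gf: "g ` f ` A = A" if "A \<subseteq> S" for A
    using that f by (auto simp: g_def bij_betw_def inv_into_image_cancel)
  have QS: "Q \<subseteq> Pow S'"
    using Q c_partitions_subset[of c S'] by (auto simp: c_partitions_containing_def)
  have "(\<lambda>A. g ` A) ` Q \<in> c_partitions c S"
    using Q image_c_partition[OF g] by (auto simp: c_partitions_containing_def)
  moreover have "T \<subseteq> (\<lambda>A. g ` A) ` Q"
  proof
    fix A assume "A \<in> T"
    then have "A = g ` f ` A" "f ` A \<in> Q"
      using gf T Q by (auto simp: c_partitions_containing_def)
    then show "A \<in> (\<lambda>A. g ` A) ` Q" by blast
  qed
  ultimately have "(\<lambda>A. g ` A) ` Q \<in> c_partitions_containing c S T"
    by (simp add: c_partitions_containing_def)
  moreover have "Q = (\<lambda>A. f ` A) ` (\<lambda>A. g ` A) ` Q"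
  proof -
    have "f ` g ` A = A" if "A \<in> Q" for A
      using that QS by (intro fg) blast
    then have "(\<lambda>A. f ` g ` A) ` Q = (\<lambda>A. A) ` Q"
      by (intro image_cong refl)
    then show ?thesis
      by (simp only: image_image image_ident)
  qed
  ultimately show "Q \<in> (\<lambda>P. (\<lambda>A. f ` A) ` P) ` c_partitions_containing c S T"
    by (rule rev_image_eqI)
qed

section \<open>Counting partitions\<close>

lemma card_c_partitions_cong:
  assumes "finite S" "finite S'" "card S = card S'"
  shows "card (c_partitions c S) = card (c_partitions c S')"
proof -
  obtain f where f: "bij_betw f S S'"
    using assms finite_same_card_bij by blast
  have "inj_on (\<lambda>P. (\<lambda>A. f ` A) ` P) (c_partitions c S)"
    using bij_betw_imp_inj_on[OF bij_betw_Pow[OF bij_betw_Pow[OF f]]] c_partitions_subset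
    by (rule inj_on_subset)
  moreover have "(\<lambda>P. (\<lambda>A. f ` A) ` P) ` c_partitions c S = c_partitions c S'"
    using image_c_partitions_containing[OF f, of "{}"]
    by (simp add: c_partitions_containing_def)
  ultimately show ?thesis
    by (metis card_image)
qed

lemma card_c_partitions:
  assumes "finite S" "c \<ge> 1" "card S = c * k"
  shows "card (c_partitions c S) = num_uniform_partitions (c * k) k"
  using card_c_partitions_cong[of S "{1..c * k}"] assms
  by (simp add: num_uniform_partitions_def uniform_partitions_eq_c_partitions)

text \<open>
  Removing the classes in \<open>T\<close> leaves an arbitrary \<open>c\<close>-partition of the points outside \<open>\<Union>T\<close>, and
  adding them back is the inverse operation.
\<close>

lemma card_c_partitions_containing:
  assumes S: "finite S" "card S = c * k" and c: "c \<ge> 1" and T: "class_family c S T"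
  shows "card (c_partitions_containing c S T)
           = num_uniform_partitions (c * (k - card T)) (k - card T)"
proof -
  note fT = card_class_family[OF S(1) T]
  have TS: "\<Union>T \<subseteq> S"
    using T by (auto simp: class_family_def)
  have ne: "{} \<notin> T"
    using T c by (auto simp: class_family_def)
  have "bij_betw (\<lambda>P. P - T) (c_partitions_containing c S T) (c_partitions c (S - \<Union>T))"
  proof (rule bij_betw_byWitness[where f' = "\<lambda>Q. Q \<union> T"])
    have "P - T \<in> c_partitions c (S - \<Union>T)" if "P \<in> c_partitions_containing c S T" for P
    proof -
      have P: "\<Union>P = S" "disjoint P" "{} \<notin> P" "\<forall>A\<in>P. card A = c" "T \<subseteq> P"
        using that by (auto simp: c_partitions_containing_def c_partitions_def partition_on_def)
      have "A \<inter> B = {}" if "A \<in> P - T" "B \<in> T" for A B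
        using P(2,5) that by (metis DiffD1 DiffD2 disjointD in_mono)
      then have "\<Union>(P - T) = S - \<Union>T"
        using P(1,5) by blast
      then show ?thesis
        using P by (auto simp: c_partitions_def partition_on_def pairwise_subset)
    qed
    then show "(\<lambda>P. P - T) ` c_partitions_containing c S T \<subseteq> c_partitions c (S - \<Union>T)"
      by blast
    have "Q \<union> T \<in> c_partitions_containing c S T" if "Q \<in> c_partitions c (S - \<Union>T)" for Q
    proof -
      have Q: "\<Union>Q = S - \<Union>T" "disjoint Q" "{} \<notin> Q" "\<forall>A\<in>Q. card A = c"
        using that by (auto simp: c_partitions_def partition_on_def)
      have "disjoint (Q \<union> T)"
        using Q(1,2) T by (intro disjoint_union) (auto simp: class_family_def)
      then show ?thesis
        using Q T TS ne
        by (auto simp: c_partitions_containing_def c_partitions_def partition_on_def class_family_def)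
    qed
    then show "(\<lambda>Q. Q \<union> T) ` c_partitions c (S - \<Union>T) \<subseteq> c_partitions_containing c S T"
      by blast
    show "\<forall>P\<in>c_partitions_containing c S T. P - T \<union> T = P"
      by (auto simp: c_partitions_containing_def)
    have "A \<notin> T" if "Q \<in> c_partitions c (S - \<Union>T)" "A \<in> Q" for Q A
    proof
      assume "A \<in> T"
      have "A \<subseteq> S - \<Union>T" "A \<noteq> {}"
        using that by (auto simp: c_partitions_def partition_on_def)
      with \<open>A \<in> T\<close> show False by blast
    qed
    then show "\<forall>Q\<in>c_partitions c (S - \<Union>T). Q \<union> T - T = Q"
      by blast
  qed
  then have "card (c_partitions_containing c S T) = card (c_partitions c (S - \<Union>T))"
    by (rule bij_betw_same_card)
  also have "\<dots> = num_uniform_partitions (c * (k - card T)) (k - card T)"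
    using S c TS fT
    by (intro card_c_partitions)
       (auto simp: card_Diff_subset finite_subset right_diff_distrib')
  finally show ?thesis .
qed

text \<open>
  Sort the partitions by the class of the point \<open>1\<close>: its other \<open>c - 1\<close> points are arbitrary, and
  the remaining points can be partitioned in the same number of ways for each choice.
\<close>

lemma num_uniform_partitions_Suc:
  assumes c: "c \<ge> 1"
  shows "num_uniform_partitions (c * Suc k) (Suc k)
           = (c * Suc k - 1 choose (c - 1)) * num_uniform_partitions (c * k) k"
proof -
  define S where "S = {1..c * Suc k}"
  have S: "finite S" "card S = c * Suc k" "1 \<in> S"
    using c by (auto simp: S_def)
  define C where "C = {A. A \<subseteq> S \<and> card A = c \<and> 1 \<in> A}"
  have fC: "finite C"
    using S(1) by (auto simp: C_def)
  have "bij_betw (\<lambda>A. A - {1}) C {B. B \<subseteq> S - {1} \<and> card B = c - 1}"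
  proof (rule bij_betw_byWitness[where f' = "insert 1"])
    show "insert 1 ` {B. B \<subseteq> S - {1} \<and> card B = c - 1} \<subseteq> C"
    proof
      fix A assume "A \<in> insert 1 ` {B. B \<subseteq> S - {1} \<and> card B = c - 1}"
      then obtain B where B: "A = insert 1 B" "B \<subseteq> S - {1}" "card B = c - 1" by blast
      then have "finite B" "1 \<notin> B"
        using S(1) finite_subset by auto
      then show "A \<in> C"
        using B c S(3) by (auto simp: C_def)
    qed
  qed (auto simp: C_def)
  then have "card C = (card (S - {1}) choose (c - 1))"
    using S(1) by (simp add: bij_betw_same_card n_subsets)
  then have cardC: "card C = (c * Suc k - 1 choose (c - 1))"
    using S by simp
  have "c_partitions c S = (\<Union>A\<in>C. c_partitions_containing c S {A})"
  proof (intro equalityI subsetI)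
    fix P assume P: "P \<in> c_partitions c S"
    then obtain A where "A \<in> P" "1 \<in> A"
      using S(3) by (auto simp: c_partitions_def partition_on_def)
    then show "P \<in> (\<Union>A\<in>C. c_partitions_containing c S {A})"
      using P by (auto simp: c_partitions_containing_def c_partitions_def partition_on_def C_def)
  qed (auto simp: c_partitions_containing_def)
  also have "card \<dots> = (\<Sum>A\<in>C. card (c_partitions_containing c S {A}))"
  proof (rule card_UN_disjoint)
    show "\<forall>A\<in>C. \<forall>B\<in>C. A \<noteq> B \<longrightarrow>
            c_partitions_containing c S {A} \<inter> c_partitions_containing c S {B} = {}"
    proof (intro ballI impI equals0I)
      fix A B P assume AB: "A \<in> C" "B \<in> C" "A \<noteq> B"
        and "P \<in> c_partitions_containing c S {A} \<inter> c_partitions_containing c S {B}"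
      then have "disjoint P" "A \<in> P" "B \<in> P"
        by (auto simp: c_partitions_containing_def c_partitions_def partition_on_def)
      then have "A \<inter> B = {}"
        using AB(3) by (meson disjointD)
      then show False
        using AB by (auto simp: C_def)
    qed
  qed (use fC S in auto)
  also have "\<dots> = (\<Sum>A\<in>C. num_uniform_partitions (c * k) k)"
  proof (rule sum.cong)
    fix A assume "A \<in> C"
    then have "class_family c S {A}"
      by (auto simp: C_def class_family_def)
    then show "card (c_partitions_containing c S {A}) = num_uniform_partitions (c * k) k"
      using card_c_partitions_containing[of S c "Suc k" "{A}"] S c by simp
  qed simp
  finally show ?thesis
    using card_c_partitions[OF S(1) c S(2)] cardC by simp
qed

lemma num_uniform_partitions_pos:
  assumes "c \<ge> 1"
  shows "num_uniform_partitions (c * k) k > 0"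
proof (induction k)
  case 0
  then show ?case by (simp add: num_uniform_partitions_0_0)
next
  case (Suc k)
  then show ?case
    unfolding num_uniform_partitions_Suc[OF assms] by simp
qed

text \<open>
  With at most one class there is nothing to choose; this settles the case \<open>k \<le> t + 1\<close>.
\<close>

lemma num_uniform_partitions_le_1:
  assumes "c \<ge> 1" "k \<le> 1"
  shows "num_uniform_partitions (c * k) k = 1"
proof (cases "k = 0")
  case False
  then have "k = Suc 0" using assms by simp
  then show ?thesis
    using num_uniform_partitions_Suc[OF assms(1), of 0] by (simp add: num_uniform_partitions_0_0)
qed (simp add: num_uniform_partitions_0_0)

section \<open>Trivially intersecting systems\<close>

text \<open>
  Match the members of the two families, map each member bijectively to its partner, and map
  the uncovered points to the uncovered points; both leftovers have the same size because the
  families cover equally many points.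
\<close>

lemma ex_permutes_image_class_family:
  assumes S: "finite S" and T: "class_family c S T" and T': "class_family c S T'"
    and eq: "card T = card T'"
  shows "\<exists>\<sigma>. \<sigma> permutes S \<and> (\<lambda>A. \<sigma> ` A) ` T = T'"
proof -
  note fT = card_class_family[OF S T] and fT' = card_class_family[OF S T']
  have sub: "\<Union>T \<subseteq> S" "\<Union>T' \<subseteq> S"
    using T T' by (auto simp: class_family_def)
  have fin: "finite A" if "A \<in> T \<union> T'" for A
    using that S sub by (meson Sup_upper UnE finite_subset)
  obtain h where h: "bij_betw h T T'"
    using finite_same_card_bij[OF fT(1) fT'(1) eq] by blast
  have hT': "h A \<in> T'" if "A \<in> T" for A
    using h that by (auto simp: bij_betw_def)
  have "\<exists>g. bij_betw g A (h A)" if "A \<in> T" for A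
    using finite_same_card_bij[of A "h A"] that fin hT'[OF that] T T'
    by (auto simp: class_family_def)
  then obtain g where g: "\<And>A. A \<in> T \<Longrightarrow> bij_betw (g A) A (h A)"
    by metis
  have "card (S - \<Union>T) = card (S - \<Union>T')"
    using S sub fT fT' eq by (simp add: card_Diff_subset finite_subset)
  then obtain r where r: "bij_betw r (S - \<Union>T) (S - \<Union>T')"
    using S finite_same_card_bij by (metis finite_Diff)
  define \<sigma> where "\<sigma> x = (if x \<in> \<Union>T then g (THE A. A \<in> T \<and> x \<in> A) x
                        else if x \<in> S then r x else x)" for x
  \<comment> \<open>Disjointness of \<open>T\<close> makes the choice of \<open>A\<close> in \<open>\<sigma>\<close> unambiguous.\<close>
  have \<sigma>g: "\<sigma> x = g A x" if "A \<in> T" "x \<in> A" for A x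
  proof -
    have "(THE A. A \<in> T \<and> x \<in> A) = A"
      using that T unfolding class_family_def
      by (intro the_equality) (auto dest: disjointD)
    then show ?thesis
      using that by (auto simp: \<sigma>_def)
  qed
  have \<sigma>A: "bij_betw \<sigma> A (h A)" if "A \<in> T" for A
    using g[OF that] \<sigma>g[OF that] by (simp cong: bij_betw_cong)
  have "disjoint T'"
    using T' by (simp add: class_family_def)
  then have "disjoint_family_on h T"
    using h unfolding disjoint_family_on_def bij_betw_def inj_on_def
    by (metis disjointD imageI)
  then have "bij_betw \<sigma> (\<Union>A\<in>T. A) (\<Union>A\<in>T. h A)"
    using \<sigma>A by (rule bij_betw_UNION_disjoint)
  then have 1: "bij_betw \<sigma> (\<Union>T) (\<Union>T')"
    using h by (simp add: bij_betw_def)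
  have 2: "bij_betw \<sigma> (S - \<Union>T) (S - \<Union>T')"
    using r by (rule iffD1[OF bij_betw_cong, rotated]) (auto simp: \<sigma>_def)
  have "bij_betw \<sigma> (\<Union>T \<union> (S - \<Union>T)) (\<Union>T' \<union> (S - \<Union>T'))"
    using 1 2 by (rule bij_betw_combine) blast
  moreover have "\<Union>T \<union> (S - \<Union>T) = S" "\<Union>T' \<union> (S - \<Union>T') = S"
    using sub by auto
  ultimately have "\<sigma> permutes S"
    using sub by (intro bij_imp_permutes) (auto simp: \<sigma>_def)
  moreover have "(\<lambda>A. \<sigma> ` A) ` T = h ` T"
    using \<sigma>A by (intro image_cong) (auto simp: bij_betw_def)
  ultimately show ?thesis
    using h by (auto simp: bij_betw_def)
qed

lemma class_family_image_permutes:
  assumes "\<sigma> permutes S" "class_family c S T"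
  shows "class_family c S ((\<lambda>A. \<sigma> ` A) ` T)" "card ((\<lambda>A. \<sigma> ` A) ` T) = card T"
proof -
  have inj: "inj \<sigma>"
    using assms(1) by (rule permutes_inj)
  have "card (\<sigma> ` A) = card A" for A
    using inj by (simp add: card_image inj_on_subset)
  moreover have "\<sigma> ` A \<subseteq> S" if "A \<subseteq> S" for A
    using that permutes_image[OF assms(1)] by blast
  moreover have "disjoint ((\<lambda>A. \<sigma> ` A) ` T)" if "disjoint T"
    using that inj by (auto simp: pairwise_def disjnt_def image_Int[symmetric])
  ultimately show "class_family c S ((\<lambda>A. \<sigma> ` A) ` T)"
    using assms(2) by (auto simp: class_family_def)
  show "card ((\<lambda>A. \<sigma> ` A) ` T) = card T"
    using inj by (intro card_image) (auto simp: inj_on_def inj_image_eq_iff)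
qed

lemma class_family_intervals:
  assumes c: "c \<ge> 1" and "t \<le> k"
  defines "I \<equiv> \<lambda>i. {i * c + 1..(i + 1) * c}"
  shows "class_family c {1..c * k} (I ` {..<t})" "card (I ` {..<t}) = t"
proof -
  have "I i \<inter> I j = {}" if "i < j" for i j
  proof -
    have "(i + 1) * c \<le> j * c"
      using that by (intro mult_right_mono) auto
    then show ?thesis by (auto simp: I_def)
  qed
  then have disj: "I i \<inter> I j = {}" if "i \<noteq> j" for i j
    using that by (metis Int_commute nat_neq_iff)
  have ne: "I i \<noteq> {}" for i
    using c by (simp add: I_def)
  have "inj_on I {..<t}"
    using disj ne by (metis inf.idem inj_onI)
  then show "card (I ` {..<t}) = t"
    by (simp add: card_image)
  have "I i \<subseteq> {1..c * k}" if "i < t" for i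
  proof -
    have "(i + 1) * c \<le> k * c"
      using that \<open>t \<le> k\<close> by (intro mult_right_mono) auto
    then show ?thesis by (auto simp: I_def mult.commute)
  qed
  moreover have "disjoint (I ` {..<t})"
    using disj by (intro pairwiseI) (metis disjnt_def imageE)
  moreover have "card (I i) = c" for i
    by (simp add: I_def)
  ultimately show "class_family c {1..c * k} (I ` {..<t})"
    by (auto simp: class_family_def)
qed

text \<open>
  Permutations of the ground set act transitively on the families of \<open>t\<close> disjoint \<open>c\<close>-sets, so
  the intervals in the canonical system may be replaced by an arbitrary such family.
\<close>

lemma trivially_t_intersecting_iff:
  assumes c: "c \<ge> 1" and k: "k \<ge> 1" "t \<le> k"
  shows "trivially_t_intersecting (c * k) k t \<P> \<longleftrightarrow>
    (\<exists>T. class_family c {1..c * k} T \<and> card T = t \<and>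
         \<P> = c_partitions_containing c {1..c * k} T)"
proof -
  define T\<^sub>0 where "T\<^sub>0 = (\<lambda>i. {i * c + 1..(i + 1) * c}) ` {..<t}"
  have T\<^sub>0: "class_family c {1..c * k} T\<^sub>0" "card T\<^sub>0 = t"
    unfolding T\<^sub>0_def using class_family_intervals[OF c k(2)] by auto
  have canon: "canonical_system (c * k) k t = c_partitions_containing c {1..c * k} T\<^sub>0"
    using k(1) uniform_partitions_eq_c_partitions[OF c, of k]
    by (simp add: canonical_system_def c_partitions_containing_def T\<^sub>0_def)
  have img: "(\<lambda>P. (\<lambda>A. \<sigma> ` A) ` P) ` canonical_system (c * k) k t
      = c_partitions_containing c {1..c * k} ((\<lambda>A. \<sigma> ` A) ` T\<^sub>0)"
    if "\<sigma> permutes {1..c * k}" for \<sigma>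
    unfolding canon using permutes_imp_bij[OF that] T\<^sub>0(1)
    by (intro image_c_partitions_containing) (auto simp: class_family_def)
  show ?thesis
  proof
    assume "trivially_t_intersecting (c * k) k t \<P>"
    then obtain \<sigma> where \<sigma>: "\<sigma> permutes {1..c * k}"
      "\<P> = (\<lambda>P. (\<lambda>A. \<sigma> ` A) ` P) ` canonical_system (c * k) k t"
      by (auto simp: trivially_t_intersecting_def)
    then show "\<exists>T. class_family c {1..c * k} T \<and> card T = t \<and>
         \<P> = c_partitions_containing c {1..c * k} T"
      using img[OF \<sigma>(1)] class_family_image_permutes[OF \<sigma>(1) T\<^sub>0(1)] T\<^sub>0(2) by blast
  next
    assume "\<exists>T. class_family c {1..c * k} T \<and> card T = t \<and>
         \<P> = c_partitions_containing c {1..c * k} T"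
    then obtain T where T: "class_family c {1..c * k} T" "card T = t"
      "\<P> = c_partitions_containing c {1..c * k} T" by blast
    obtain \<sigma> where "\<sigma> permutes {1..c * k}" "(\<lambda>A. \<sigma> ` A) ` T\<^sub>0 = T"
      using ex_permutes_image_class_family[OF _ T\<^sub>0(1) T(1)] T\<^sub>0(2) T(2) by auto
    then show "trivially_t_intersecting (c * k) k t \<P>"
      unfolding trivially_t_intersecting_def using img T(3) by metis
  qed
qed

section \<open>Nontrivial intersecting systems\<close>

text \<open>
  The members of \<open>\<P>\<close> meet a fixed \<open>P \<in> \<P>\<close> in some \<open>T\<close> of size \<open>t\<close>, and nontriviality yields
  some \<open>Q \<in> \<P>\<close> that forces one further class, from \<open>Q - T\<close>, on every member of \<open>\<P>\<close> that contains
  \<open>T\<close>. So \<open>t + 1\<close> classes are prescribed, in at most \<open>(k choose t) k\<close> ways.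
\<close>

lemma card_nontrivial_t_intersecting_le:
  fixes S :: "nat set"
  assumes S: "finite S" "card S = c * k" and c: "c \<ge> 1"
    and \<P>: "\<P> \<subseteq> c_partitions c S" "t_intersecting t \<P>"
    and nontriv: "\<nexists>T. class_family c S T \<and> card T = t \<and> (\<forall>P\<in>\<P>. T \<subseteq> P)"
  shows "card \<P> \<le> (k choose t) * (k * num_uniform_partitions (c * (k - Suc t)) (k - Suc t))"
proof (cases "\<P> = {}")
  case False
  then obtain P where P: "P \<in> \<P>" by blast
  define U where "U = num_uniform_partitions (c * (k - Suc t)) (k - Suc t)"
  define \<T> where "\<T> = {T. T \<subseteq> P \<and> card T = t}"
  have fin: "finite Q" "card Q = k" if "Q \<in> \<P>" for Q
    using card_c_partition[OF S(1) c S(2), of Q] that \<P>(1) by auto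
  have card_\<T>: "finite \<T>" "card \<T> = (k choose t)"
    using fin[OF P] by (auto simp: \<T>_def n_subsets)
  have "\<P> \<subseteq> (\<Union>T\<in>\<T>. \<P> \<inter> c_partitions_containing c S T)"
  proof
    fix R assume R: "R \<in> \<P>"
    then have "t \<le> card (P \<inter> R)"
      using P \<P>(2) by (auto simp: t_intersecting_def)
    then obtain T where "T \<subseteq> P \<inter> R" "card T = t"
      by (meson obtain_subset_with_card_n)
    then show "R \<in> (\<Union>T\<in>\<T>. \<P> \<inter> c_partitions_containing c S T)"
      using R \<P>(1) by (auto simp: \<T>_def c_partitions_containing_def)
  qed
  then have "card \<P> \<le> card (\<Union>T\<in>\<T>. \<P> \<inter> c_partitions_containing c S T)"
    using S card_\<T> by (intro card_mono) auto
  also have "\<dots> \<le> (\<Sum>T\<in>\<T>. card (\<P> \<inter> c_partitions_containing c S T))"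
    using card_\<T>(1) by (rule card_UN_le)
  also have "\<dots> \<le> of_nat (card \<T>) * (k * U)"
  proof (rule sum_bounded_above)
    fix T assume "T \<in> \<T>"
    then have T: "T \<subseteq> P" "card T = t" by (auto simp: \<T>_def)
    have "finite T"
      using T(1) fin(1)[OF P] finite_subset by blast
    have "class_family c S T"
      using T(1) P \<P>(1) class_family_if_subset by blast
    then obtain Q where Q: "Q \<in> \<P>" "\<not> T \<subseteq> Q"
      using nontriv T(2) by blast
    have "\<P> \<inter> c_partitions_containing c S T
            \<subseteq> (\<Union>B\<in>Q - T. c_partitions_containing c S (insert B T))"
    proof
      fix R assume R: "R \<in> \<P> \<inter> c_partitions_containing c S T"
      then have "t \<le> card (Q \<inter> R)"
        using Q \<P>(2) by (auto simp: t_intersecting_def)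
      moreover have "card (Q \<inter> T) < t"
        using Q(2) T(2) \<open>finite T\<close> by (metis inf_le2 inf.absorb_iff2 psubsetI psubset_card_mono)
      ultimately have "\<not> Q \<inter> R \<subseteq> Q \<inter> T"
        using \<open>finite T\<close> by (metis card_mono finite_Int leD le_trans)
      then obtain B where "B \<in> Q" "B \<in> R" "B \<notin> T" by blast
      then show "R \<in> (\<Union>B\<in>Q - T. c_partitions_containing c S (insert B T))"
        using R by (auto simp: c_partitions_containing_def)
    qed
    then have "card (\<P> \<inter> c_partitions_containing c S T)
                 \<le> card (\<Union>B\<in>Q - T. c_partitions_containing c S (insert B T))"
      using S fin[OF Q(1)] by (intro card_mono) auto
    also have "\<dots> \<le> (\<Sum>B\<in>Q - T. card (c_partitions_containing c S (insert B T)))"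
      using fin[OF Q(1)] by (intro card_UN_le) auto
    also have "\<dots> \<le> of_nat (card (Q - T)) * U"
    proof (rule sum_bounded_above)
      fix B assume B: "B \<in> Q - T"
      show "card (c_partitions_containing c S (insert B T)) \<le> U"
      \<comment> \<open>If \<open>B\<close> meets a member of \<open>T\<close>, no partition contains both, and the count is \<open>0\<close>.\<close>
      proof (cases "c_partitions_containing c S (insert B T) = {}")
        case False
        then obtain R where "R \<in> c_partitions c S" "insert B T \<subseteq> R"
          using B by (auto simp: c_partitions_containing_def)
        then have "class_family c S (insert B T)"
          by (rule class_family_if_subset)
        moreover have "card (insert B T) = Suc t"
          using B T(2) \<open>finite T\<close> by simp
        ultimately show ?thesis
          using card_c_partitions_containing[OF S c] by (simp add: U_def)
      qed simp
    qed
    also have "\<dots> \<le> k * U"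
      using fin[OF Q(1)] card_mono[of Q "Q - T"] by simp
    finally show "card (\<P> \<inter> c_partitions_containing c S T) \<le> k * U" .
  qed
  finally show ?thesis
    using card_\<T>(2) by (simp add: U_def)
qed simp

text \<open>
  Once \<open>t\<close> classes are known, at most \<open>c\<close> points remain, and these form at most one class.
\<close>

lemma t_intersecting_eq_if_few_classes:
  fixes S :: "nat set"
  assumes S: "finite S" "card S = c * k" and c: "c \<ge> 1" and k: "k \<le> Suc t"
    and \<P>: "\<P> \<subseteq> c_partitions c S" "t_intersecting t \<P>" and P: "P \<in> \<P>" and Q: "Q \<in> \<P>"
  shows "P = Q"
proof -
  have "t \<le> card (P \<inter> Q)"
    using \<P>(2) P Q by (auto simp: t_intersecting_def)
  then obtain T where T: "T \<subseteq> P \<inter> Q" "card T = t"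
    by (meson obtain_subset_with_card_n)
  have "class_family c S T"
    using T(1) P \<P>(1) class_family_if_subset by blast
  then have "card (c_partitions_containing c S T) = 1"
    using card_c_partitions_containing[OF S c] num_uniform_partitions_le_1[OF c, of "k - t"] k T(2)
    by simp
  moreover have "P \<in> c_partitions_containing c S T" "Q \<in> c_partitions_containing c S T"
    using P Q T(1) \<P>(1) by (auto simp: c_partitions_containing_def)
  ultimately show ?thesis
    by (metis card_1_singletonE singletonD)
qed

section \<open>Binomial estimates\<close>

lemma power_less_binomial:
  fixes a m s :: nat
  assumes "a * s < m" "s \<ge> 1" "a \<ge> 1"
  shows "a ^ s < (m choose s)"
proof -
  have s: "real s > 0"
    using assms(2) by simp
  have "real a * real s < real m"
    unfolding of_nat_mult[symmetric] of_nat_less_iff by (rule assms(1))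
  then have "real a < real m / real s"
    unfolding pos_less_divide_eq[OF s] .
  then have "real a ^ s < (real m / real s) ^ s"
    by (rule power_strict_mono) (use assms(2) in linarith)+
  also have "s \<le> m"
    using assms(1) mult_le_mono1[OF assms(3), of s] by linarith
  then have "(real m / real s) ^ s \<le> real (m choose s)"
    by (rule binomial_ge_n_over_k_pow_k)
  finally show ?thesis
    unfolding of_nat_power[symmetric] of_nat_less_iff .
qed

lemma binomial_le_power: "(n choose s) \<le> n ^ s"
proof (cases "s \<le> n")
  case True
  then show ?thesis by (rule binomial_le_pow)
qed (simp add: binomial_eq_0)

text \<open>
  As \<open>k - t \<ge> 2\<close>, the right side is at least \<open>2c - 1 choose (c - 1)\<close>, hence exceeds
  \<open>2 ^ (c - 1) \<ge> c\<close>.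
\<close>

lemma binomial_bound_large_classes:
  assumes k: "t + 2 \<le> k" and c: "(k choose t) * k < c"
  shows "(k choose t) * k < (c * (k - t) - 1 choose (c - 1))"
proof -
  have "k \<le> (k choose t) * k"
    using k by (simp add: Suc_le_eq)
  then have c2: "c \<ge> 2"
    using k c by linarith
  have "c * 2 \<le> c * (k - t)"
    using k by (intro mult_left_mono) auto
  then have "2 ^ (c - 1) < (c * (k - t) - 1 choose (c - 1))"
    using c2 by (intro power_less_binomial) linarith+
  moreover have "c - 1 < 2 ^ (c - 1)"
    by (rule less_exp)
  ultimately show ?thesis
    using c by linarith
qed

text \<open>
  The right side is compared with \<open>k ^ (c - 1)\<close> through \<open>power_less_binomial\<close>. This requires
  \<open>k (c - 1) < c (k - t) - 1\<close>, which says precisely that \<open>k > t c + 1\<close>. The left side is at most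
  \<open>k ^ (t + 1)\<close>, and \<open>t + 1 \<le> c - 1\<close>.
\<close>

lemma binomial_bound_many_classes:
  assumes c: "t + 2 \<le> c" and k: "t * c + 2 \<le> k"
  shows "(k choose t) * k < (c * (k - t) - 1 choose (c - 1))"
proof -
  have "t * 1 \<le> t * c"
    using c by (intro mult_left_mono) auto
  then have "t \<le> k"
    using k by linarith
  have "(k choose t) * k \<le> k ^ t * k"
    using binomial_le_power by (rule mult_right_mono) simp
  also have "\<dots> = k ^ Suc t"
    by simp
  also have "\<dots> \<le> k ^ (c - 1)"
    using c k by (intro power_increasing) auto
  also have "\<dots> < (c * (k - t) - 1 choose (c - 1))"
  proof (rule power_less_binomial)
    have "c * (k - t) = k * c - t * c" "k * (c - 1) = k * c - k"
      by (simp_all add: algebra_simps)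
    moreover have "k * 1 \<le> k * c"
      using c by (intro mult_left_mono) auto
    ultimately show "k * (c - 1) < c * (k - t) - 1"
      using k by linarith
  qed (use c k in auto)
  finally show ?thesis .
qed

section \<open>The extremal theorem\<close>

text \<open>
  The alternative behind the theorem: without \<open>t\<close> common classes the bound is missed strictly.
  For \<open>k \<le> t + 1\<close> such a system has to be empty, as a nonempty one is a singleton and has all the
  classes of its member in common.
\<close>

lemma t_intersecting_trivial_or_small:
  assumes c: "c \<ge> 1" and t: "t \<le> k"
    and bound: "k \<le> Suc t \<or> (k choose t) * k < (c * (k - t) - 1 choose (c - 1))"
    and \<P>: "\<P> \<subseteq> c_partitions c {1..c * k}" "t_intersecting t \<P>"
  shows "(\<exists>T. class_family c {1..c * k} T \<and> card T = t \<and> (\<forall>P\<in>\<P>. T \<subseteq> P)) \<or>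
    card \<P> < num_uniform_partitions (c * (k - t)) (k - t)"
  unfolding disj_imp
proof (rule impI)
  assume nontriv: "\<nexists>T. class_family c {1..c * k} T \<and> card T = t \<and> (\<forall>P\<in>\<P>. T \<subseteq> P)"
  show "card \<P> < num_uniform_partitions (c * (k - t)) (k - t)"
  proof (cases "t + 2 \<le> k")
    case True
    define U where "U = num_uniform_partitions (c * (k - Suc t)) (k - Suc t)"
    have "card \<P> \<le> (k choose t) * k * U"
      using card_nontrivial_t_intersecting_le[OF _ _ c \<P> nontriv] by (simp add: U_def mult.assoc)
    also have "\<dots> < (c * (k - t) - 1 choose (c - 1)) * U"
      using bound True num_uniform_partitions_pos[OF c] by (simp add: U_def)
    also have "\<dots> = num_uniform_partitions (c * (k - t)) (k - t)"
      using num_uniform_partitions_Suc[OF c, of "k - Suc t"] True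
      by (simp add: U_def Suc_diff_Suc)
    finally show ?thesis .
  next
    case False
    have "\<P> = {}"
    proof (rule ccontr)
      assume "\<P> \<noteq> {}"
      then obtain P where P: "P \<in> \<P>" by blast
      have "card P = k"
        using card_c_partition(2)[of "{1..c * k}" c k P] P \<P>(1) c by auto
      then obtain T where T: "T \<subseteq> P" "card T = t"
        using t by (metis obtain_subset_with_card_n)
      have "P = Q" if "Q \<in> \<P>" for Q
        using t_intersecting_eq_if_few_classes[of "{1..c * k}" c k, OF _ _ c _ \<P> P that] False by simp
      then have "\<forall>Q\<in>\<P>. T \<subseteq> Q"
        using T(1) by blast
      moreover have "class_family c {1..c * k} T"
        using T(1) P \<P>(1) class_family_if_subset by blast
      ultimately show False
        using nontriv T(2) by blast
    qed
    then show ?thesis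
      using num_uniform_partitions_pos[OF c] by simp
  qed
qed

text \<open>
  The threshold \<open>n\<^sub>0\<close> expresses \<open>c > (k choose t) k\<close> and \<open>n\<^sub>1\<close> expresses \<open>k \<ge> t c + 2\<close>, both scaled
  to \<open>n = c k\<close>.
\<close>

theorem theorem7p2p4:
  "\<exists>n\<^sub>0 n\<^sub>1 :: nat \<Rightarrow> nat \<Rightarrow> nat.
     \<forall>(n::nat) (k::nat) (t::nat) (c::nat) (\<P> :: nat set set set).
       n \<ge> 1 \<longrightarrow> c \<ge> 1 \<longrightarrow> t \<ge> 1 \<longrightarrow> k \<ge> t \<longrightarrow> n = c * k \<longrightarrow>
       (n \<ge> n\<^sub>0 k t \<or> (c \<ge> t + 2 \<and> n \<ge> n\<^sub>1 c t)) \<longrightarrow>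
       \<P> \<subseteq> uniform_partitions n k \<longrightarrow> t_intersecting t \<P> \<longrightarrow>
         card \<P> \<le> num_uniform_partitions (n - t * c) (k - t) \<and>
         (card \<P> = num_uniform_partitions (n - t * c) (k - t) \<longleftrightarrow>
            trivially_t_intersecting n k t \<P>)"
proof (rule exI[of _ "\<lambda>k t. ((k choose t) * k + 1) * k"],
    rule exI[of _ "\<lambda>c t. c * (t * c + 2)"], intro allI impI)
  fix n k t c :: nat and \<P> :: "nat set set set"
  assume n1: "n \<ge> 1" and c: "c \<ge> 1" and t: "t \<ge> 1" "k \<ge> t" and n: "n = c * k"
    and large: "n \<ge> ((k choose t) * k + 1) * k \<or> (c \<ge> t + 2 \<and> n \<ge> c * (t * c + 2))"
    and "\<P> \<subseteq> uniform_partitions n k" and int: "t_intersecting t \<P>"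
  then have \<P>: "\<P> \<subseteq> c_partitions c {1..c * k}"
    using uniform_partitions_eq_c_partitions[OF c] by simp
  have k: "k \<ge> 1"
    using t by simp
  have "(k choose t) * k < c \<or> (t + 2 \<le> c \<and> t * c + 2 \<le> k)"
    using large k c unfolding n by (auto simp: Suc_le_eq simp del: mult_Suc mult_Suc_right)
  then have bound: "k \<le> Suc t \<or> (k choose t) * k < (c * (k - t) - 1 choose (c - 1))"
    using binomial_bound_large_classes[of t k c] binomial_bound_many_classes[of t c k] by linarith
  define U where "U = num_uniform_partitions (c * (k - t)) (k - t)"
  have U: "num_uniform_partitions (n - t * c) (k - t) = U"
    by (simp add: U_def n right_diff_distrib' mult.commute)
  have card_containing: "card (c_partitions_containing c {1..c * k} T) = U"
    if "class_family c {1..c * k} T" "card T = t" for T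
    using card_c_partitions_containing[OF _ _ c that(1)] that(2) by (simp add: U_def)
  note triv_iff = trivially_t_intersecting_iff[OF c k t(2), of \<P>]
  have "card \<P> \<le> U \<and> (card \<P> = U \<longleftrightarrow> trivially_t_intersecting (c * k) k t \<P>)"
    using t_intersecting_trivial_or_small[OF c t(2) bound \<P> int]
  proof (elim disjE exE conjE)
    fix T assume T: "class_family c {1..c * k} T" "card T = t" and "\<forall>P\<in>\<P>. T \<subseteq> P"
    then have sub: "\<P> \<subseteq> c_partitions_containing c {1..c * k} T"
      using \<P> by (auto simp: c_partitions_containing_def)
    have "card \<P> \<le> U"
      using card_mono[OF _ sub] card_containing[OF T] by simp
    moreover have "trivially_t_intersecting (c * k) k t \<P>" if "card \<P> = U"
    proof -
      have "\<P> = c_partitions_containing c {1..c * k} T"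
        using card_subset_eq[OF _ sub] card_containing[OF T] that by simp
      then show ?thesis
        using triv_iff T by blast
    qed
    moreover have "card \<P> = U" if "trivially_t_intersecting (c * k) k t \<P>"
      using that card_containing unfolding triv_iff by blast
    ultimately show ?thesis by blast
  next
    assume "card \<P> < num_uniform_partitions (c * (k - t)) (k - t)"
    then show ?thesis
      using card_containing triv_iff unfolding U_def[symmetric] by auto
  qed
  then show "card \<P> \<le> num_uniform_partitions (n - t * c) (k - t) \<and>
      (card \<P> = num_uniform_partitions (n - t * c) (k - t) \<longleftrightarrow>
        trivially_t_intersecting n k t \<P>)"
    by (simp only: U n[symmetric])
qed

end
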